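(* The quasi-crystal graph $\mathcal{Q}_{\mathcal{C}}$ is seminormal and satisfies the local quasi-crystal axioms LQ1, LQ2, LQ3 and LQ3$'$.
   Context: Work in type $A_{n-1}$: index set $I=\{1<\cdots<n-1\}$, simple roots $\alpha_i=\mathbf{e}_i-\mathbf{e}_{i+1}$ with $\alpha_i^\vee=\alpha_i$. A crystal is a set $\mathcal{C}$ with maps $\widetilde{e}_i,\widetilde{f}_i:\mathcal{C}\to\mathcal{C}\sqcup\{\bot\}$, $\widetilde{\varepsilon}_i,\widetilde{\varphi}_i:\mathcal{C}\to\mathbb{Z}\sqcup\{-\infty\}$, $\mathrm{wt}$, such that $\widetilde{e}_i(x)=y$ iff $x=\widetilde{f}_i(y)$, in which case $\mathrm{wt}(y)=\mathrm{wt}(x)+\alpha_i$, $\widetilde{\varepsilon}_i(y)=\widetilde{\varepsilon}_i(x)-1$, $\widetilde{\varphi}_i(y)=\widetilde{\varphi}_i(x)+1$; $\widetilde{\varphi}_i(x)=\widetilde{\varepsilon}_i(x)+\langle\mathrm{wt}(x),\alpha_i\rangle$; and $\widetilde{\varepsilon}_i(x)=-\infty$ forces $\widetilde{e}_i(x)=\widetilde{f}_i(x)=\bot$. It is seminormal if $\widetilde{\varepsilon}_i(x)=\max\{k:\widetilde{e}_i^{\,k}(x)\neq\bot\}$ and $\widetilde{\varphi}_i(x)=\max\{k:\widetilde{f}_i^{\,k}(x)\neq\bot\}$. A Stembridge crystal is a seminormal crystal satisfying, for $i\neq j$: (S1) if $\widetilde{e}_i(x)=y$ then $\widetilde{\varepsilon}_j(y)\in\{\widetilde{\varepsilon}_j(x),\widetilde{\varepsilon}_j(x)+1\}$,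 the latter only if $\langle\alpha_i,\alpha_j\rangle=-1$ (i.e. $|i-j|=1$); (S2) if $\widetilde{e}_i(x)=y$ and $\widetilde{\varepsilon}_j(y)=\widetilde{\varepsilon}_j(x)>0$ then $\widetilde{e}_i\widetilde{e}_j(x)=\widetilde{e}_j\widetilde{e}_i(x)\neq\bot$ and $\widetilde{\varphi}_i(\widetilde{e}_j(x))=\widetilde{\varphi}_i(x)$; (S3) if $\widetilde{e}_i(x)=y$, $\widetilde{e}_j(x)=z$, $\widetilde{\varepsilon}_j(y)=\widetilde{\varepsilon}_j(x)+1$, $\widetilde{\varepsilon}_i(z)=\widetilde{\varepsilon}_i(x)+1$, then $\widetilde{e}_i\widetilde{e}_j^{\,2}\widetilde{e}_i(x)=\widetilde{e}_j\widetilde{e}_i^{\,2}\widetilde{e}_j(x)\neq\bot$ (with the corresponding $\widetilde{\varphi}$ equalities); and the dual axioms S2$'$, S3$'$ with $\widetilde{f},\widetilde{\varphi}$ replacing $\widetilde{e},\widetilde{\varepsilon}$. Let $\mathcal{C}$ be a connected Stembridge crystal of type $A_{n-1}$, with weight lattice $\mathbb{Z}^n$ modulo $\mathbf{e}_1+\cdots+\mathbf{e}_n$, the representative chosen so that highest weights are partitions (so all entries $\mathrm{wt}_k(x)$ are nonnegative). A quasi-crystal is defined like a crystal except $\ddot{\varepsilon}_i,\ddot{\varphi}_i$ take values in $\mathbb{Z}\sqcup\{-\infty,+\infty\}$, and additionally $\ddot{\varepsilon}_i(x)=+\infty$ forces $\ddot{e}_i(x)=\ddot{f}_i(x)=\bot$;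 it is seminormal if the max formulas above hold whenever $\ddot{\varepsilon}_i(x)\neq+\infty$. Define $\mathcal{Q}_{\mathcal{C}}$: same underlying set, index set and weight as $\mathcal{C}$, with $\ddot{\varepsilon}_i(x)=\widetilde{\varepsilon}_i(x)$ if $\widetilde{\varepsilon}_i(x)=\mathrm{wt}_{i+1}(x)$ and $+\infty$ otherwise; $\ddot{e}_i(x)=\widetilde{e}_i(x)$ if $\widetilde{\varepsilon}_i(x)=\mathrm{wt}_{i+1}(x)$ and $\bot$ otherwise; $\ddot{\varphi}_i(x)=\ddot{\varepsilon}_i(x)+\langle\mathrm{wt}(x),\alpha_i\rangle$; $\ddot{f}_i(x)=y$ iff $\ddot{e}_i(y)=x$. Local axioms, for $i,j\in I$, $x,y\in\mathcal{Q}$: (LQ1) for $i+1\in I$, $\ddot{\varepsilon}_i(x)=0\Leftrightarrow\ddot{\varphi}_{i+1}(x)=0$. (LQ2) if $\ddot{e}_i(x)=y$ then: (1) $\ddot{\varepsilon}_j(x)=\ddot{\varepsilon}_j(y)$ for $|i-j|>1$; (2) for $i+1\in I$, $\ddot{\varepsilon}_{i+1}(x)\neq\ddot{\varepsilon}_{i+1}(y)\Leftrightarrow(\ddot{\varepsilon}_{i+1}(x)=+\infty\wedge\ddot{\varepsilon}_i(y)=0)\Rightarrow\ddot{\varepsilon}_{i+1}(y)\neq0$; (3) for $i-1\in I$, $\ddot{\varphi}_{i-1}(x)\neq\ddot{\varphi}_{i-1}(y)\Leftrightarrow(\ddot{\varphi}_{i-1}(y)=+\infty\wedge\ddot{\varphi}_i(x)=0)\Rightarrow\ddot{\varphi}_{i-1}(x)\neq0$.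 (LQ3) for $i\neq j$, if $\ddot{e}_i(x)$ and $\ddot{e}_j(x)$ are both defined then $\ddot{e}_i\ddot{e}_j(x)=\ddot{e}_j\ddot{e}_i(x)\neq\bot$. (LQ3$'$) the same with $\ddot{f}$ in place of $\ddot{e}$. *)

theory Defs
  imports Main "HOL-Library.Extended"
begin

text \<open>
  Crystals and quasi-crystals of type \<open>A\<^bsub>n-1\<^esub>\<close> share the same data.
  The value \<open>\<bottom>\<close> is \<^const>\<open>None\<close>.  Vectors of \<open>\<int>\<^sup>n\<close> are functions \<open>nat \<Rightarrow> int\<close> of which
  only the coordinates \<open>1, \<dots>, n\<close> are relevant.
\<close>

record 'a crystal_data =
  elems :: "'a set"
  eop :: "nat \<Rightarrow> 'a \<Rightarrow> 'a option"
  fop :: "nat \<Rightarrow> 'a \<Rightarrow> 'a option"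
  eps :: "nat \<Rightarrow> 'a \<Rightarrow> int extended"
  phi :: "nat \<Rightarrow> 'a \<Rightarrow> int extended"
  wt :: "'a \<Rightarrow> nat \<Rightarrow> int"

definition index_set :: "nat \<Rightarrow> nat set" where
  "index_set n = {1..<n}"

definition unit_vec :: "nat \<Rightarrow> nat \<Rightarrow> int" where
  "unit_vec i k = (if k = i then 1 else 0)"

definition simple_root :: "nat \<Rightarrow> nat \<Rightarrow> int" where
  "simple_root i k = unit_vec i k - unit_vec (i + 1) k"

definition pairing :: "nat \<Rightarrow> (nat \<Rightarrow> int) \<Rightarrow> (nat \<Rightarrow> int) \<Rightarrow> int" where
  "pairing n v w = (\<Sum>k=1..n. v k * w k)"

text \<open>\<open>op_word g [i\<^sub>1, \<dots>, i\<^sub>r] x\<close> is \<open>g\<^bsub>i\<^sub>1\<^esub> \<dots> g\<^bsub>i\<^sub>r\<^esub> x\<close>: the rightmost operator acts first,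
  and \<open>\<bottom>\<close> is propagated.\<close>

fun op_word :: "(nat \<Rightarrow> 'a \<Rightarrow> 'a option) \<Rightarrow> nat list \<Rightarrow> 'a \<Rightarrow> 'a option" where
  "op_word g [] x = Some x"
| "op_word g (i # w) x = Option.bind (op_word g w x) (g i)"

definition crystal_core :: "nat \<Rightarrow> 'a crystal_data \<Rightarrow> bool" where
  "crystal_core n C \<longleftrightarrow>
     (\<forall>i\<in>index_set n. \<forall>x\<in>elems C.
        (\<forall>y. eop C i x = Some y \<longrightarrow> y \<in> elems C) \<and>
        (\<forall>y. fop C i x = Some y \<longrightarrow> y \<in> elems C) \<and>
        (\<forall>y\<in>elems C. eop C i x = Some y \<longleftrightarrow> fop C i y = Some x) \<and>
        (\<forall>y\<in>elems C. eop C i x = Some y \<longrightarrow>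
           (\<forall>k\<in>{1..n}. wt C y k = wt C x k + simple_root i k) \<and>
           eps C i y = eps C i x - 1 \<and>
           phi C i y = phi C i x + 1) \<and>
        phi C i x = eps C i x + Fin (pairing n (wt C x) (simple_root i)) \<and>
        (eps C i x = Minf \<longrightarrow> eop C i x = None \<and> fop C i x = None))"

definition crystal :: "nat \<Rightarrow> 'a crystal_data \<Rightarrow> bool" where
  "crystal n C \<longleftrightarrow> crystal_core n C \<and>
     (\<forall>i\<in>index_set n. \<forall>x\<in>elems C. eps C i x \<noteq> Pinf \<and> phi C i x \<noteq> Pinf)"

definition quasi_crystal :: "nat \<Rightarrow> 'a crystal_data \<Rightarrow> bool" where
  "quasi_crystal n Q \<longleftrightarrow> crystal_core n Q \<and>
     (\<forall>i\<in>index_set n. \<forall>x\<in>elems Q.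
        eps Q i x = Pinf \<longrightarrow> eop Q i x = None \<and> fop Q i x = None)"

text \<open>\<open>is_string_length g i x v\<close>: the maximum of \<open>{k. g\<^sub>i\<^sup>k(x) \<noteq> \<bottom>}\<close> exists and equals \<open>v\<close>.
  The set always contains \<open>0\<close>.\<close>

definition is_string_length ::
    "(nat \<Rightarrow> 'a \<Rightarrow> 'a option) \<Rightarrow> nat \<Rightarrow> 'a \<Rightarrow> int extended \<Rightarrow> bool" where
  "is_string_length g i x v \<longleftrightarrow>
     finite {k. op_word g (replicate k i) x \<noteq> None} \<and>
     v = Fin (int (Max {k. op_word g (replicate k i) x \<noteq> None}))"

definition seminormal_crystal :: "nat \<Rightarrow> 'a crystal_data \<Rightarrow> bool" where
  "seminormal_crystal n C \<longleftrightarrow> crystal n C \<and>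
     (\<forall>i\<in>index_set n. \<forall>x\<in>elems C.
        is_string_length (eop C) i x (eps C i x) \<and>
        is_string_length (fop C) i x (phi C i x))"

definition seminormal_quasi_crystal :: "nat \<Rightarrow> 'a crystal_data \<Rightarrow> bool" where
  "seminormal_quasi_crystal n Q \<longleftrightarrow> quasi_crystal n Q \<and>
     (\<forall>i\<in>index_set n. \<forall>x\<in>elems Q. eps Q i x \<noteq> Pinf \<longrightarrow>
        is_string_length (eop Q) i x (eps Q i x) \<and>
        is_string_length (fop Q) i x (phi Q i x))"

definition stembridge_S1 :: "nat \<Rightarrow> 'a crystal_data \<Rightarrow> bool" where
  "stembridge_S1 n C \<longleftrightarrow>
     (\<forall>i\<in>index_set n. \<forall>j\<in>index_set n. i \<noteq> j \<longrightarrow>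
       (\<forall>x\<in>elems C. \<forall>y\<in>elems C. eop C i x = Some y \<longrightarrow>
          eps C j y \<in> {eps C j x, eps C j x + 1} \<and>
          (eps C j y = eps C j x + 1 \<longrightarrow>
             pairing n (simple_root i) (simple_root j) = -1)))"

text \<open>The axioms S2 and S3 are stated for operators \<open>g\<close> and string lengths \<open>d\<close>, \<open>d'\<close>;
  they are used with \<open>(g, d, d') = (e, \<epsilon>, \<phi>)\<close>, and with \<open>(f, \<phi>, \<epsilon>)\<close> for the dual axioms.\<close>

definition stembridge_S2 ::
    "nat \<Rightarrow> 'a set \<Rightarrow> (nat \<Rightarrow> 'a \<Rightarrow> 'a option) \<Rightarrow>
     (nat \<Rightarrow> 'a \<Rightarrow> int extended) \<Rightarrow> (nat \<Rightarrow> 'a \<Rightarrow> int extended) \<Rightarrow> bool" where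
  "stembridge_S2 n X g d d' \<longleftrightarrow>
     (\<forall>i\<in>index_set n. \<forall>j\<in>index_set n. i \<noteq> j \<longrightarrow>
       (\<forall>x\<in>X. \<forall>y\<in>X. g i x = Some y \<and> d j y = d j x \<and> d j x > 0 \<longrightarrow>
          op_word g [i, j] x = op_word g [j, i] x \<and>
          op_word g [i, j] x \<noteq> None \<and>
          d' i (the (g j x)) = d' i x))"

definition stembridge_S3 ::
    "nat \<Rightarrow> 'a set \<Rightarrow> (nat \<Rightarrow> 'a \<Rightarrow> 'a option) \<Rightarrow>
     (nat \<Rightarrow> 'a \<Rightarrow> int extended) \<Rightarrow> (nat \<Rightarrow> 'a \<Rightarrow> int extended) \<Rightarrow> bool" where
  "stembridge_S3 n X g d d' \<longleftrightarrow>
     (\<forall>i\<in>index_set n. \<forall>j\<in>index_set n. i \<noteq> j \<longrightarrow>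
       (\<forall>x\<in>X. \<forall>y\<in>X. \<forall>z\<in>X.
          g i x = Some y \<and> g j x = Some z \<and> d j y = d j x + 1 \<and> d i z = d i x + 1 \<longrightarrow>
          op_word g [i, j, j, i] x = op_word g [j, i, i, j] x \<and>
          op_word g [i, j, j, i] x \<noteq> None \<and>
          d' i z = d' i (the (op_word g [j, j, i] x)) \<and>
          d' j y = d' j (the (op_word g [i, i, j] x))))"

definition stembridge_crystal :: "nat \<Rightarrow> 'a crystal_data \<Rightarrow> bool" where
  "stembridge_crystal n C \<longleftrightarrow>
     seminormal_crystal n C \<and>
     stembridge_S1 n C \<and>
     stembridge_S2 n (elems C) (eop C) (eps C) (phi C) \<and>
     stembridge_S3 n (elems C) (eop C) (eps C) (phi C) \<and>
     stembridge_S2 n (elems C) (fop C) (phi C) (eps C) \<and>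
     stembridge_S3 n (elems C) (fop C) (phi C) (eps C)"

definition crystal_edges :: "nat \<Rightarrow> 'a crystal_data \<Rightarrow> ('a \<times> 'a) set" where
  "crystal_edges n C =
     {(x, y). x \<in> elems C \<and> y \<in> elems C \<and> (\<exists>i\<in>index_set n. fop C i x = Some y)}"

definition connected_crystal :: "nat \<Rightarrow> 'a crystal_data \<Rightarrow> bool" where
  "connected_crystal n C \<longleftrightarrow>
     (\<forall>x\<in>elems C. \<forall>y\<in>elems C. (x, y) \<in> (crystal_edges n C \<union> (crystal_edges n C)\<inverse>)\<^sup>*)"

definition highest_weight_elem :: "nat \<Rightarrow> 'a crystal_data \<Rightarrow> 'a \<Rightarrow> bool" where
  "highest_weight_elem n C x \<longleftrightarrow> x \<in> elems C \<and> (\<forall>i\<in>index_set n. eop C i x = None)"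

definition is_partition :: "nat \<Rightarrow> (nat \<Rightarrow> int) \<Rightarrow> bool" where
  "is_partition n v \<longleftrightarrow> (\<forall>k\<in>{1..n}. 0 \<le> v k) \<and> (\<forall>k\<in>{1..<n}. v (k + 1) \<le> v k)"

text \<open>
  The weight lattice is \<open>\<int>\<^sup>n\<close> modulo \<open>e\<^sub>1 + \<dots> + e\<^sub>n\<close>, and \<^const>\<open>wt\<close> is a lift of the weight map
  to \<open>\<int>\<^sup>n\<close> that still satisfies \<open>wt (e\<^sub>i x) = wt x + \<alpha>\<^sub>i\<close>.  On a connected crystal such a lift
  is unique up to adding one constant multiple of \<open>e\<^sub>1 + \<dots> + e\<^sub>n\<close> to all weights; the next
  condition is the normalization of that constant.
\<close>

definition partition_highest_weights :: "nat \<Rightarrow> 'a crystal_data \<Rightarrow> bool" where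
  "partition_highest_weights n C \<longleftrightarrow>
     (\<forall>x. highest_weight_elem n C x \<longrightarrow> is_partition n (wt C x))"

definition qc_eps :: "'a crystal_data \<Rightarrow> nat \<Rightarrow> 'a \<Rightarrow> int extended" where
  "qc_eps C i x = (if eps C i x = Fin (wt C x (i + 1)) then eps C i x else Pinf)"

definition qc_eop :: "'a crystal_data \<Rightarrow> nat \<Rightarrow> 'a \<Rightarrow> 'a option" where
  "qc_eop C i x = (if eps C i x = Fin (wt C x (i + 1)) then eop C i x else None)"

definition qc_phi :: "nat \<Rightarrow> 'a crystal_data \<Rightarrow> nat \<Rightarrow> 'a \<Rightarrow> int extended" where
  "qc_phi n C i x = qc_eps C i x + Fin (pairing n (wt C x) (simple_root i))"

text \<open>The partial inverse of \<^const>\<open>qc_eop\<close>, which is injective where defined.\<close>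

definition qc_fop :: "'a crystal_data \<Rightarrow> nat \<Rightarrow> 'a \<Rightarrow> 'a option" where
  "qc_fop C i x =
     (if \<exists>y\<in>elems C. qc_eop C i y = Some x
      then Some (THE y. y \<in> elems C \<and> qc_eop C i y = Some x) else None)"

definition quasi_crystal_of :: "nat \<Rightarrow> 'a crystal_data \<Rightarrow> 'a crystal_data" where
  "quasi_crystal_of n C =
     \<lparr>elems = elems C, eop = qc_eop C, fop = qc_fop C,
      eps = qc_eps C, phi = qc_phi n C, wt = wt C\<rparr>"

definition LQ1 :: "nat \<Rightarrow> 'a crystal_data \<Rightarrow> bool" where
  "LQ1 n Q \<longleftrightarrow>
     (\<forall>i\<in>index_set n. i + 1 \<in> index_set n \<longrightarrow>
       (\<forall>x\<in>elems Q. eps Q i x = 0 \<longleftrightarrow> phi Q (i + 1) x = 0))"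

text \<open>In parts (2) and (3) the chain \<open>A \<Leftrightarrow> B \<Rightarrow> C\<close> means that \<open>A \<Leftrightarrow> B\<close> and \<open>B \<Rightarrow> C\<close>.\<close>

definition LQ2 :: "nat \<Rightarrow> 'a crystal_data \<Rightarrow> bool" where
  "LQ2 n Q \<longleftrightarrow>
     (\<forall>i\<in>index_set n. \<forall>x\<in>elems Q. \<forall>y\<in>elems Q. eop Q i x = Some y \<longrightarrow>
        (\<forall>j\<in>index_set n. \<bar>int i - int j\<bar> > 1 \<longrightarrow> eps Q j x = eps Q j y) \<and>
        (i + 1 \<in> index_set n \<longrightarrow>
           (eps Q (i + 1) x \<noteq> eps Q (i + 1) y \<longleftrightarrow>
              eps Q (i + 1) x = Pinf \<and> eps Q i y = 0) \<and>
           (eps Q (i + 1) x = Pinf \<and> eps Q i y = 0 \<longrightarrow> eps Q (i + 1) y \<noteq> 0)) \<and>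
        (i - 1 \<in> index_set n \<longrightarrow>
           (phi Q (i - 1) x \<noteq> phi Q (i - 1) y \<longleftrightarrow>
              phi Q (i - 1) y = Pinf \<and> phi Q i x = 0) \<and>
           (phi Q (i - 1) y = Pinf \<and> phi Q i x = 0 \<longrightarrow> phi Q (i - 1) x \<noteq> 0)))"

definition LQ3 :: "nat \<Rightarrow> 'a crystal_data \<Rightarrow> bool" where
  "LQ3 n Q \<longleftrightarrow>
     (\<forall>i\<in>index_set n. \<forall>j\<in>index_set n. i \<noteq> j \<longrightarrow>
       (\<forall>x\<in>elems Q. eop Q i x \<noteq> None \<and> eop Q j x \<noteq> None \<longrightarrow>
          op_word (eop Q) [i, j] x = op_word (eop Q) [j, i] x \<and>
          op_word (eop Q) [i, j] x \<noteq> None))"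

definition LQ3' :: "nat \<Rightarrow> 'a crystal_data \<Rightarrow> bool" where
  "LQ3' n Q \<longleftrightarrow>
     (\<forall>i\<in>index_set n. \<forall>j\<in>index_set n. i \<noteq> j \<longrightarrow>
       (\<forall>x\<in>elems Q. fop Q i x \<noteq> None \<and> fop Q j x \<noteq> None \<longrightarrow>
          op_word (fop Q) [i, j] x = op_word (fop Q) [j, i] x \<and>
          op_word (fop Q) [i, j] x \<noteq> None))"

end

theory Submission
  imports Defs
begin

text \<open>
  Everything rests on the bounds \<open>\<epsilon>\<^sub>i(x) \<le> wt\<^bsub>i+1\<^esub>(x)\<close> and \<open>\<phi>\<^sub>i(x) \<le> wt\<^sub>i(x)\<close>, that is, on the
  nonnegativity of all weights.  The axioms S1, S2 and S2' show that above every element there is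
  a highest weight element, reached by maximal powers of the \<open>e\<^sub>i\<close> along a reduced word of the
  longest permutation.  If \<open>wt\<^sub>k(x)\<close> is negative, then so is \<open>wt\<^bsub>k+1\<^esub>\<close> at the upper end of the
  \<open>k\<close>-string of \<open>x\<close>; hence the last coordinate of some weight is negative.  As raising operators
  never increase the last coordinate, this contradicts the normalization of the highest weights.
  Given the bounds, \<open>i\<close> is active at \<open>x\<close> in the quasi-crystal iff one of them (equivalently,
  both) is an equality, and the local axioms follow because S2 and S2' would otherwise
  produce a neighbour violating a bound.
\<close>

section \<open>String lengths in Stembridge crystals\<close>

lemma pairing_simple_root:
  assumes "i \<in> index_set n"
  shows "pairing n v (simple_root i) = v i - v (i + 1)"
proof -
  have "pairing n v (simple_root i) =
      (\<Sum>k=1..n. (if k = i then v k else 0) - (if k = i + 1 then v k else 0))"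
    unfolding pairing_def simple_root_def unit_vec_def by (intro sum.cong) auto
  also have "\<dots> = v i - v (i + 1)"
    using assms by (simp add: sum_subtractf index_set_def)
  finally show ?thesis .
qed

lemma op_word_replicate_mono:
  assumes "op_word g (replicate k i) x \<noteq> None" and "l \<le> k"
  shows "op_word g (replicate l i) x \<noteq> None"
  using assms(2,1) by (induction rule: dec_induct) (auto split: bind_splits)

text \<open>The defining equation of \<open>op_word\<close> splits off the operator that acts last;
  comparing strings needs the one that acts first.\<close>

lemma op_word_replicate_Suc:
  "op_word g (replicate (Suc k) i) x = Option.bind (g i x) (op_word g (replicate k i))"
  by (induction k) (simp_all add: bind_assoc)

lemma is_string_length_nonneg:
  assumes "is_string_length g i x v"
  obtains m where "v = Fin m" "0 \<le> m" "g i x \<noteq> None \<longleftrightarrow> 0 < m"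
proof -
  let ?K = "{k. op_word g (replicate k i) x \<noteq> None}"
  have fin: "finite ?K" and v: "v = Fin (int (Max ?K))"
    using assms by (auto simp: is_string_length_def)
  have "0 \<in> ?K" by simp
  then have max: "Max ?K \<in> ?K" using fin by (metis (no_types, lifting) Max_in empty_iff)
  have "g i x \<noteq> None \<longleftrightarrow> 1 \<in> ?K" by simp
  also have "\<dots> \<longleftrightarrow> 1 \<le> Max ?K"
    using max op_word_replicate_mono[of g "Max ?K" i x 1] Max_ge[OF fin, of 1] by blast
  finally show thesis using that[of "int (Max ?K)"] v by auto
qed

locale stembridge =
  fixes n :: nat and C :: "'a crystal_data"
  assumes stembridge: "stembridge_crystal n C"
begin

abbreviation "I \<equiv> index_set n"
abbreviation "X \<equiv> elems C"
abbreviation "e \<equiv> eop C"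
abbreviation "f \<equiv> fop C"

text \<open>Seminormality makes \<open>eps C i x\<close> finite for \<open>i \<in> I\<close> and
  \<open>x \<in> X\<close>, so there the description denotes its integer value; likewise for
  \<open>ph\<close>.\<close>

definition ep :: "nat \<Rightarrow> 'a \<Rightarrow> int" where "ep i x = (THE k. eps C i x = Fin k)"
definition ph :: "nat \<Rightarrow> 'a \<Rightarrow> int" where "ph i x = (THE k. phi C i x = Fin k)"

lemma core: "crystal_core n C"
  using stembridge by (simp add: stembridge_crystal_def seminormal_crystal_def crystal_def)

context
  fixes i x assumes ix: "i \<in> I" "x \<in> X"
begin

lemma eps_eq: "eps C i x = Fin (ep i x)"
  and ep_nonneg: "0 \<le> ep i x"
  and e_defined_iff: "e i x \<noteq> None \<longleftrightarrow> 0 < ep i x"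
proof -
  have "is_string_length e i x (eps C i x)"
    using stembridge ix by (simp add: stembridge_crystal_def seminormal_crystal_def)
  then obtain m where "eps C i x = Fin m" "0 \<le> m" "e i x \<noteq> None \<longleftrightarrow> 0 < m"
    by (rule is_string_length_nonneg)
  then show "eps C i x = Fin (ep i x)" "0 \<le> ep i x" "e i x \<noteq> None \<longleftrightarrow> 0 < ep i x"
    by (simp_all add: ep_def)
qed

lemma phi_eq: "phi C i x = Fin (ph i x)"
  and ph_nonneg: "0 \<le> ph i x"
  and f_defined_iff: "f i x \<noteq> None \<longleftrightarrow> 0 < ph i x"
proof -
  have "is_string_length f i x (phi C i x)"
    using stembridge ix by (simp add: stembridge_crystal_def seminormal_crystal_def)
  then obtain m where "phi C i x = Fin m" "0 \<le> m" "f i x \<noteq> None \<longleftrightarrow> 0 < m"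
    by (rule is_string_length_nonneg)
  then show "phi C i x = Fin (ph i x)" "0 \<le> ph i x" "f i x \<noteq> None \<longleftrightarrow> 0 < ph i x"
    by (simp_all add: ph_def)
qed

lemma ph_eq: "ph i x = ep i x + wt C x i - wt C x (i + 1)"
proof -
  have "phi C i x = eps C i x + Fin (pairing n (wt C x) (simple_root i))"
    using core ix unfolding crystal_core_def by blast
  then show ?thesis by (simp add: phi_eq eps_eq pairing_simple_root ix)
qed

end

lemma e_closed: "i \<in> I \<Longrightarrow> x \<in> X \<Longrightarrow> e i x = Some y \<Longrightarrow> y \<in> X"
  and f_closed: "i \<in> I \<Longrightarrow> x \<in> X \<Longrightarrow> f i x = Some y \<Longrightarrow> y \<in> X"
  and e_iff_f: "i \<in> I \<Longrightarrow> x \<in> X \<Longrightarrow> y \<in> X \<Longrightarrow> e i x = Some y \<longleftrightarrow> f i y = Some x"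
  using core unfolding crystal_core_def by blast+

lemma wt_e:
  "\<lbrakk>i \<in> I; x \<in> X; e i x = Some y; k \<in> {1..n}\<rbrakk> \<Longrightarrow> wt C y k = wt C x k + simple_root i k"
  using core e_closed unfolding crystal_core_def by blast

context
  fixes i x y assumes ixy: "i \<in> I" "x \<in> X" "e i x = Some y"
begin

lemma wt_e_i: "wt C y i = wt C x i + 1"
  using wt_e[OF ixy, of i] ixy by (simp add: simple_root_def unit_vec_def index_set_def)

lemma wt_e_Suc: "wt C y (i + 1) = wt C x (i + 1) - 1"
  using wt_e[OF ixy, of "i + 1"] ixy by (simp add: simple_root_def unit_vec_def index_set_def)

lemma wt_e_other: "k \<in> {1..n} \<Longrightarrow> k \<noteq> i \<Longrightarrow> k \<noteq> i + 1 \<Longrightarrow> wt C y k = wt C x k"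
  using wt_e[OF ixy] by (simp add: simple_root_def unit_vec_def)

lemma ep_e_same: "ep i y = ep i x - 1"
proof -
  have "y \<in> X" using ixy e_closed by blast
  then have "eps C i y = eps C i x - 1" using core ixy unfolding crystal_core_def by blast
  then show ?thesis using ixy \<open>y \<in> X\<close> by (simp add: eps_eq one_extended_def)
qed

lemma ph_e_same: "ph i y = ph i x + 1"
  using ep_e_same wt_e_i wt_e_Suc ph_eq[of i x] ph_eq[of i y] ixy e_closed by force

lemma ep_e_cases:
  assumes "j \<in> I" "j \<noteq> i"
  shows "ep j y = ep j x \<or> ep j y = ep j x + 1 \<and> (j = i + 1 \<or> i = j + 1)"
proof -
  have y: "y \<in> X" using ixy e_closed by blast
  have "stembridge_S1 n C" using stembridge by (simp add: stembridge_crystal_def)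
  then have "eps C j y \<in> {eps C j x, eps C j x + 1} \<and>
      (eps C j y = eps C j x + 1 \<longrightarrow> pairing n (simple_root i) (simple_root j) = -1)"
    using ixy y assms unfolding stembridge_S1_def by metis
  then show ?thesis
    using ixy y assms
    by (auto simp: eps_eq one_extended_def pairing_simple_root simple_root_def unit_vec_def
        split: if_splits)
qed

text \<open>The difference is the pairing of the weight with alpha_j. With \<open>ep_e_cases\<close>
  this gives a dichotomy for adjacent indices: e_i either raises \<open>ep j\<close> by one and
  keeps \<open>ph j\<close>, or keeps \<open>ep j\<close> and lowers \<open>ph j\<close> by
  one.\<close>

lemma ph_e_diff:
  assumes "j \<in> I" "j \<noteq> i"
  shows "ph j x - ep j x = ph j y - ep j y + (if j = i + 1 \<or> i = j + 1 then 1 else 0)"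
proof -
  have "y \<in> X" using ixy e_closed by blast
  then show ?thesis
    using ph_eq[of j x] ph_eq[of j y] wt_e[OF ixy, of j] wt_e[OF ixy, of "j + 1"] ixy assms
    by (auto simp: simple_root_def unit_vec_def index_set_def)
qed

lemma ep_e_far:
  assumes "j \<in> I" "j \<noteq> i" "j \<noteq> i + 1" "i \<noteq> j + 1"
  shows "ep j y = ep j x"
  using ep_e_cases assms by blast

end

lemma S2_e:
  assumes "i \<in> I" "j \<in> I" "i \<noteq> j" "x \<in> X" "e i x = Some y" "ep j y = ep j x" "0 < ep j x"
  obtains z w where "e j x = Some z" "e i z = Some w" "e j y = Some w" "ph i z = ph i x"
proof -
  have y: "y \<in> X" using assms e_closed by blast
  have "stembridge_S2 n X e (eps C) (phi C)"
    using stembridge by (simp add: stembridge_crystal_def)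
  moreover have "e i x = Some y \<and> eps C j y = eps C j x \<and> eps C j x > 0"
    using assms y by (simp add: eps_eq zero_extended_def)
  ultimately have *: "op_word e [i, j] x = op_word e [j, i] x \<and>
      op_word e [i, j] x \<noteq> None \<and> phi C i (the (e j x)) = phi C i x"
    using assms(1-4) y unfolding stembridge_S2_def by blast
  then obtain z w where zw: "e j x = Some z" "e i z = Some w" by (auto split: bind_splits)
  then have "z \<in> X" using assms e_closed by blast
  then show thesis using that[of z w] zw * assms by (simp add: phi_eq)
qed

lemma S2_f:
  assumes "i \<in> I" "j \<in> I" "i \<noteq> j" "x \<in> X" "f i x = Some y" "ph j y = ph j x" "0 < ph j x"
  obtains z w where "f j x = Some z" "f i z = Some w" "f j y = Some w" "ep i z = ep i x"
proof -
  have y: "y \<in> X" using assms f_closed by blast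
  have "stembridge_S2 n X f (phi C) (eps C)"
    using stembridge by (simp add: stembridge_crystal_def)
  moreover have "f i x = Some y \<and> phi C j y = phi C j x \<and> phi C j x > 0"
    using assms y by (simp add: phi_eq zero_extended_def)
  ultimately have *: "op_word f [i, j] x = op_word f [j, i] x \<and>
      op_word f [i, j] x \<noteq> None \<and> eps C i (the (f j x)) = eps C i x"
    using assms(1-4) y unfolding stembridge_S2_def by blast
  then obtain z w where zw: "f j x = Some z" "f i z = Some w" by (auto split: bind_splits)
  then have "z \<in> X" using assms f_closed by blast
  then show thesis using that[of z w] zw * assms by (simp add: eps_eq)
qed


section \<open>Existence of highest weight elements\<close>

text \<open>
  Given \<open>\<epsilon>\<^sub>i(v) = 0\<close> at the start, \<open>\<epsilon>\<^sub>i\<close> along the \<open>e\<^sub>j\<close>-string of \<open>v\<close> vanishes for a while and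
  then grows at every step.  The predicate \<open>tight i j\<close> records this shape; since it survives \<open>e\<^sub>i\<close>
  with \<open>\<epsilon>\<^sub>j\<close> unchanged, applying \<open>e\<^sub>j\<close> and then \<open>e\<^sub>i\<close> as often as possible kills both
  \<open>\<epsilon>\<^sub>i\<close> and \<open>\<epsilon>\<^sub>j\<close>.
\<close>

inductive tight :: "nat \<Rightarrow> nat \<Rightarrow> 'a \<Rightarrow> bool" for i j where
  tight_zero: "x \<in> X \<Longrightarrow> ep i x = 0 \<Longrightarrow> tight i j x"
| tight_step: "tight i j v \<Longrightarrow> v \<in> X \<Longrightarrow> e j v = Some u \<Longrightarrow> ep i u = ep i v + 1 \<Longrightarrow> tight i j u"

text \<open>If e_i raised \<open>ep j\<close> at \<open>u\<close>, then \<open>ph j\<close> would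
  stay the same and be positive, so S2' at \<open>t\<close> would give a square with corner
  \<open>z = f j t\<close> and \<open>ep i z = ep i t\<close>. But \<open>z\<close> is also
  \<open>e i v\<close>, and counting along i-strings gives
  \<open>ep i z = ep i t - 1\<close>.\<close>

lemma ep_e_after_increase:
  assumes "i \<in> I" "j \<in> I" "i \<noteq> j" "v \<in> X" "e j v = Some u" "ep i u = ep i v + 1" "e i u = Some t"
  shows "ep j t = ep j u"
proof (rule ccontr)
  assume "ep j t \<noteq> ep j u"
  have u: "u \<in> X" and t: "t \<in> X" using assms e_closed by blast+
  have adj: "ep j t = ep j u + 1" "j = i + 1 \<or> i = j + 1"
    using ep_e_cases[OF _ u assms(7), of j] assms \<open>ep j t \<noteq> ep j u\<close> by auto
  then have "ph j t = ph j u"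
    using ph_e_diff[OF _ u assms(7), of j] assms by auto
  moreover have "ph j u = ph j v + 1" "0 \<le> ph j v"
    using ph_e_same ph_nonneg assms by blast+
  moreover have "f i t = Some u" "f j u = Some v"
    using e_iff_f assms u t by blast+
  ultimately obtain z where z: "f j t = Some z" "f i z = Some v" "ep i z = ep i t"
    using S2_f[of i j t u] assms t by (metis add_strict_increasing2 option.inject zero_less_one add.commute)
  have "z \<in> X" using z t f_closed assms by blast
  then have "e i v = Some z" using z e_iff_f assms by blast
  then have "ep i z = ep i v - 1" using ep_e_same assms by blast
  moreover have "ep i t = ep i u - 1" using ep_e_same assms u by blast
  ultimately show False using z assms by simp
qed

text \<open>Here \<open>e i u\<close> is defined and keeps \<open>ep j\<close>, so S2 at
  \<open>u\<close> gives \<open>ph i w = ph i u\<close>. For adjacent indices an unchanged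
  \<open>ph i\<close> means that \<open>ep i\<close> rises.\<close>

lemma ep_convex:
  assumes "i \<in> I" "j \<in> I" "i \<noteq> j" "v \<in> X" "e j v = Some u" "ep i u = ep i v + 1" "e j u = Some w"
  shows "ep i w = ep i u + 1"
proof -
  have u: "u \<in> X" using assms e_closed by blast
  have "0 < ep i u" using assms ep_nonneg[of i v] by simp
  then obtain t where t: "e i u = Some t" using e_defined_iff assms u by blast
  have "ep j t = ep j u" using ep_e_after_increase assms t by blast
  moreover have "0 < ep j u" using e_defined_iff[of j u] assms u by simp
  ultimately obtain s where "e i w = Some s" "ph i w = ph i u" "e j t = Some s"
    using S2_e[of i j u t] assms u t by (metis option.inject)
  then show ?thesis
    using ph_e_diff[OF assms(2) u assms(7), of i] ep_e_cases[OF assms(2,4,5), of i] assms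
    by auto
qed

lemma tight_e_snd:
  assumes "i \<in> I" "j \<in> I" "i \<noteq> j" "tight i j x" "x \<in> X" "e j x = Some y"
  shows "tight i j y"
  using assms(4)
proof cases
  case tight_zero
  have "y \<in> X" using assms e_closed by blast
  then show ?thesis
    using ep_e_cases[OF assms(2,5,6), of i] assms tight_zero
    by (metis tight.tight_zero tight.tight_step)
next
  case (tight_step v)
  then show ?thesis using ep_convex[of i j v x y] assms tight.tight_step by blast
qed

lemma tight_e_fst:
  assumes "i \<in> I" "j \<in> I" "i \<noteq> j" "tight i j x" "x \<in> X" "e i x = Some y"
  shows "tight i j y \<and> ep j y = ep j x"
  using assms(4-)
proof (induction arbitrary: y)
  case (tight_zero x)
  then show ?case using e_defined_iff assms by fastforce
next
  case (tight_step v u)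
  have u: "u \<in> X" and y: "y \<in> X" using tight_step assms e_closed by blast+
  have j: "ep j y = ep j u" using ep_e_after_increase tight_step assms by blast
  have iy: "ep i y = ep i v" using ep_e_same[of i u y] tight_step assms u by simp
  have "tight i j y"
  proof (cases "ep i v = 0")
    case True
    then show ?thesis using iy y tight.tight_zero by simp
  next
    case False
    \<comment> \<open>The last derivation step is transported along e_i: S2 at \<open>v\<close>
      closes the square, so \<open>y\<close> is \<open>e j s\<close>, and \<open>ep i\<close> still
      grows by one from \<open>s\<close> to \<open>y\<close>.\<close>
    then obtain s where s: "e i v = Some s"
      using e_defined_iff[of i v] ep_nonneg[of i v] tight_step assms by force
    then have IH: "tight i j s" "ep j s = ep j v" using tight_step by blast+
    have "0 < ep j v" using e_defined_iff[of j v] tight_step assms by simp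
    then have "e j s = Some y"
      using S2_e[of i j v s] IH s tight_step assms by (metis option.inject)
    moreover have "ep i y = ep i s + 1" using iy s ep_e_same[of i v s] tight_step assms by simp
    moreover have "s \<in> X" using s tight_step assms e_closed by blast
    ultimately show ?thesis using IH tight.tight_step by blast
  qed
  then show ?case using j by blast
qed

text \<open>For climbing an i-string to its upper end while an invariant \<open>P\<close> is
  maintained.\<close>

lemma raise_to_top:
  assumes "i \<in> I" "x \<in> X" "P x" "\<And>u v. \<lbrakk>u \<in> X; P u; e i u = Some v\<rbrakk> \<Longrightarrow> P v"
  shows "\<exists>y\<in>X. P y \<and> ep i y = 0"
  using assms(2,3)
proof (induction "nat (ep i x)" arbitrary: x rule: less_induct)
  case less
  show ?case
  proof (cases "e i x")
    case None
    then show ?thesis using less e_defined_iff[of i x] ep_nonneg[of i x] assms(1) by force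
  next
    case (Some y)
    then have "nat (ep i y) < nat (ep i x)"
      using ep_e_same[of i x y] e_defined_iff[of i x] less assms(1) by simp
    then show ?thesis using less Some assms e_closed by blast
  qed
qed

text \<open>Only alpha_{n-1} involves coordinate \<open>n\<close>, with coefficient -1. Thus a lower
  bound for this coordinate at a highest weight element passes to the elements below it.\<close>

lemma wt_n_e:
  assumes "i \<in> I" "x \<in> X" "e i x = Some y"
  shows "wt C y n \<le> wt C x n"
  using wt_e[OF assms, of n] assms(1) by (auto simp: simple_root_def unit_vec_def index_set_def)

text \<open>Passing from \<open>K\<close> to \<open>K + 1\<close> takes one sweep through e_{K+1},
  e_K, ..., e_1, each applied up to the end of its string. Every raise moves the only possibly
  nonzero length one index down, until it disappears.\<close>

lemma ep_zero_up_to: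
  assumes "x \<in> X"
  shows "K < n \<Longrightarrow> \<exists>y\<in>X. wt C y n \<le> wt C x n \<and> (\<forall>i\<in>{1..K}. ep i y = 0)"
proof (induction K)
  case 0
  then show ?case using assms by auto
next
  case (Suc K)
  \<comment> \<open>\<open>Q m\<close> is the state before index \<open>m\<close> is raised. For
    \<open>m = Suc K\<close> the tightness clause is void, and \<open>Q 0\<close> says that all the
    lengths vanish.\<close>
  define Q where "Q m z \<longleftrightarrow> wt C z n \<le> wt C x n \<and>
    (\<forall>i\<in>{1..Suc K}. i \<noteq> m \<longrightarrow> ep i z = 0) \<and> (m \<in> {1..K} \<longrightarrow> tight m (m + 1) z)" for m z
  have "\<exists>z\<in>X. Q (Suc K - d) z" if "d \<le> Suc K" for d
    using that
  proof (induction d)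
    case 0
    obtain y where "y \<in> X" "wt C y n \<le> wt C x n" "\<forall>i\<in>{1..K}. ep i y = 0"
      using Suc by auto
    then show ?case by (auto simp: Q_def le_Suc_eq)
  next
    case (Suc d)
    define m where "m = Suc K - d"
    have m: "1 \<le> m" "m \<le> Suc K" "Suc K - Suc d = m - 1" using Suc.prems by (auto simp: m_def)
    have in_I: "i \<in> I" if "1 \<le> i" "i \<le> Suc K" for i
      using that \<open>Suc K < n\<close> by (simp add: index_set_def)
    obtain z where z: "z \<in> X" "Q m z" using Suc by (auto simp: m_def)
    \<comment> \<open>The invariant along the m-string: it preserves the tightness relative to
      \<open>m + 1\<close> and builds up the tightness of \<open>m - 1\<close> that the next raise
      needs, starting from \<open>ep (m - 1) z = 0\<close>.\<close>
    define P where "P u \<longleftrightarrow> wt C u n \<le> wt C x n \<and>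
      (\<forall>i\<in>{1..Suc K}. i \<noteq> m \<longrightarrow> i \<noteq> m - 1 \<longrightarrow> ep i u = 0) \<and>
      (m \<le> K \<longrightarrow> tight m (m + 1) u) \<and> (2 \<le> m \<longrightarrow> tight (m - 1) m u)" for u
    have "tight (m - 1) m z" if "2 \<le> m"
    proof (rule tight_zero)
      have "m - 1 \<in> {1..Suc K}" "m - 1 \<noteq> m" using m that by auto
      then show "ep (m - 1) z = 0" using z unfolding Q_def by blast
    qed (rule z)
    then have "P z" using z m by (auto simp: P_def Q_def)
    moreover have "P v" if u: "u \<in> X" "P u" "e m u = Some v" for u v
    proof -
      have mI: "m \<in> I" using m in_I by blast
      have "wt C v n \<le> wt C x n" using u wt_n_e[OF mI u(1,3)] by (simp add: P_def)
      \<comment> \<open>Tightness is what keeps \<open>ep (m + 1)\<close>, which is already zero,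
        from growing again.\<close>
      moreover have fst: "tight m (m + 1) v \<and> ep (m + 1) v = ep (m + 1) u" if "m \<le> K"
        using tight_e_fst[of m "m + 1" u v] u mI in_I[of "m + 1"] that by (simp add: P_def)
      moreover have "tight (m - 1) m v" if "2 \<le> m"
        using tight_e_snd[of "m - 1" m u v] u mI in_I[of "m - 1"] that m by (simp add: P_def)
      moreover have "ep i v = 0" if i: "i \<in> {1..Suc K}" "i \<noteq> m" "i \<noteq> m - 1" for i
      proof (cases "i = m + 1")
        case True
        then show ?thesis using fst u i by (simp add: P_def)
      next
        case False
        then show ?thesis using ep_e_far[OF mI u(1,3), of i] in_I u i by (auto simp: P_def)
      qed
      ultimately show ?thesis by (simp add: P_def)
    qed
    ultimately obtain y where "y \<in> X" "P y" "ep m y = 0"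
      using raise_to_top[of m z P] in_I m z by blast
    then have "Q (m - 1) y" using m by (auto simp: P_def Q_def)
    then show ?case using \<open>y \<in> X\<close> m by auto
  qed
  from this[of "Suc K"] show ?case by (auto simp: Q_def)
qed

lemma highest_weight_above:
  assumes "x \<in> X" "0 < n"
  obtains y where "highest_weight_elem n C y" "wt C y n \<le> wt C x n"
proof -
  obtain y where y: "y \<in> X" "wt C y n \<le> wt C x n" "\<forall>i\<in>{1..n - 1}. ep i y = 0"
    using ep_zero_up_to[OF assms(1), of "n - 1"] assms(2) by auto
  have "e i y = None" if "i \<in> I" for i
    using y e_defined_iff[of i y] that by (auto simp: index_set_def)
  then show thesis using that[of y] y by (simp add: highest_weight_elem_def)
qed

lemma top_of_string:
  assumes "x \<in> X" "i \<in> I"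
  obtains y where "y \<in> X" "wt C y (i + 1) = wt C x (i + 1) - ep i x"
proof -
  \<comment> \<open>Each e_i lowers \<open>ep i\<close> and coordinate \<open>i + 1\<close> by one,
    so their difference is invariant.\<close>
  have "\<exists>y\<in>X. ep i y - wt C y (i + 1) = ep i x - wt C x (i + 1) \<and> ep i y = 0"
    using assms ep_e_same[of i] wt_e_Suc[of i]
    by (intro raise_to_top) auto
  then show thesis using that by force
qed

end

section \<open>The quasi-crystal of a Stembridge crystal\<close>

locale normalized_stembridge = stembridge +
  assumes partition: "partition_highest_weights n C"
begin

section \<open>Nonnegativity of weights and the bounds on string lengths\<close>

lemma wt_nonneg:
  assumes "x \<in> X" "k \<in> {1..n}"
  shows "0 \<le> wt C x k"
proof -
  have "k \<le> n" "1 \<le> k" using assms by auto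
  then show ?thesis using assms(1)
  proof (induction arbitrary: x rule: inc_induct)
    case base
    then obtain y where "highest_weight_elem n C y" "wt C y n \<le> wt C x n"
      using highest_weight_above[of x] by auto
    moreover have "n \<in> {1..n}" using base by simp
    ultimately show ?case
      using partition unfolding partition_highest_weights_def is_partition_def by force
  next
    case (step k)
    then have k: "k \<in> I" by (simp add: index_set_def)
    \<comment> \<open>By \<open>ph_eq\<close>, coordinate \<open>k + 1\<close> of \<open>y\<close>
      equals \<open>wt C x k - ph k x\<close>, so its nonnegativity yields that of
      \<open>wt C x k\<close>.\<close>
    then obtain y where "y \<in> X" "wt C y (k + 1) = wt C x (k + 1) - ep k x"
      using top_of_string step by blast
    then show ?case
      using step ph_eq[OF k, of x] ph_nonneg[OF k, of x] by force
  qed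
qed

text \<open>At the upper end of the i-string, coordinate \<open>i + 1\<close> has dropped by
  \<open>ep i x\<close> and is still nonnegative.\<close>

lemma ep_le_wt:
  assumes "x \<in> X" "i \<in> I"
  shows "ep i x \<le> wt C x (i + 1)"
proof -
  obtain y where "y \<in> X" "wt C y (i + 1) = wt C x (i + 1) - ep i x"
    using top_of_string assms by blast
  then show ?thesis using wt_nonneg[of y "i + 1"] assms by (simp add: index_set_def)
qed

lemma ph_le_wt:
  assumes "x \<in> X" "i \<in> I"
  shows "ph i x \<le> wt C x i"
  using ph_eq[of i x] ep_le_wt assms by force

text \<open>Equality in \<open>ep_le_wt\<close> and, by \<open>aligned_iff_ph\<close>, in
  \<open>ph_le_wt\<close>. It is constant along i-strings, so the quasi-crystal keeps or deletes all
  edges of an i-string together.\<close>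

definition aligned :: "nat \<Rightarrow> 'a \<Rightarrow> bool" where
  "aligned i x \<longleftrightarrow> ep i x = wt C x (i + 1)"

lemma aligned_iff_ph:
  assumes "x \<in> X" "i \<in> I"
  shows "aligned i x \<longleftrightarrow> ph i x = wt C x i"
  using ph_eq[of i x] assms by (auto simp: aligned_def)

lemma aligned_e_iff:
  assumes "i \<in> I" "x \<in> X" "e i x = Some y"
  shows "aligned i y \<longleftrightarrow> aligned i x"
  using ep_e_same wt_e_Suc assms by (simp add: aligned_def)

section \<open>The quasi-crystal in terms of alignment\<close>

lemma qc_eps_eq:
  "i \<in> I \<Longrightarrow> x \<in> X \<Longrightarrow> qc_eps C i x = (if aligned i x then Fin (wt C x (i + 1)) else Pinf)"
  by (simp add: qc_eps_def eps_eq aligned_def)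

text \<open>Together with \<open>qc_eps_eq\<close> this turns LQ1 and LQ2 into statements about
  alignment and coordinates of weights.\<close>

lemma qc_phi_eq:
  "i \<in> I \<Longrightarrow> x \<in> X \<Longrightarrow> qc_phi n C i x = (if aligned i x then Fin (wt C x i) else Pinf)"
  by (simp add: qc_phi_def qc_eps_eq pairing_simple_root)

lemma qc_eop_eq:
  "i \<in> I \<Longrightarrow> x \<in> X \<Longrightarrow> qc_eop C i x = (if aligned i x then e i x else None)"
  by (simp add: qc_eop_def eps_eq aligned_def)

text \<open>Alignment passes between the ends of an i-edge, so the partial inverse of the restricted
  e_i is the restriction of f_i to aligned elements.\<close>

lemma qc_eop_Some_iff:
  assumes "i \<in> I" "x \<in> X" "y \<in> X"
  shows "qc_eop C i y = Some x \<longleftrightarrow> aligned i x \<and> f i x = Some y"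
  using assms by (auto simp: qc_eop_eq e_iff_f aligned_e_iff split: if_splits)

lemma qc_fop_eq:
  assumes "i \<in> I" "x \<in> X"
  shows "qc_fop C i x = (if aligned i x then f i x else None)"
proof (cases "aligned i x \<and> f i x \<noteq> None")
  case True
  then obtain y where y: "f i x = Some y" "y \<in> X" using f_closed assms by blast
  then have "(THE y. y \<in> X \<and> qc_eop C i y = Some x) = y"
    using assms True by (intro the_equality) (auto simp: qc_eop_Some_iff)
  then show ?thesis using assms True y by (auto simp: qc_fop_def qc_eop_Some_iff)
next
  case False
  then show ?thesis using assms by (auto simp: qc_fop_def qc_eop_Some_iff)
qed

lemma op_word_qc_eop:
  assumes "i \<in> I" "x \<in> X" "aligned i x"
  shows "op_word (qc_eop C) (replicate k i) x = op_word e (replicate k i) x"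
  using assms(2,3)
proof (induction k arbitrary: x)
  case (Suc k)
  have "op_word (qc_eop C) (replicate k i) y = op_word e (replicate k i) y"
    if "e i x = Some y" for y
    using Suc that assms(1) e_closed aligned_e_iff by blast
  then show ?case
    using Suc.prems assms(1)
    by (cases "e i x") (simp_all only: op_word_replicate_Suc qc_eop_eq if_True Option.bind.simps)
qed simp

lemma op_word_qc_fop:
  assumes "i \<in> I" "x \<in> X" "aligned i x"
  shows "op_word (qc_fop C) (replicate k i) x = op_word f (replicate k i) x"
  using assms(2,3)
proof (induction k arbitrary: x)
  case (Suc k)
  have "op_word (qc_fop C) (replicate k i) y = op_word f (replicate k i) y"
    if "f i x = Some y" for y
    using Suc that assms(1) f_closed e_iff_f aligned_e_iff by metis
  then show ?case
    using Suc.prems assms(1)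
    by (cases "f i x") (simp_all only: op_word_replicate_Suc qc_fop_eq if_True Option.bind.simps)
qed simp

lemma seminormal: "seminormal_quasi_crystal n (quasi_crystal_of n C)"
proof -
  let ?Q = "quasi_crystal_of n C"
  have "crystal_core n ?Q"
    unfolding crystal_core_def
  proof (intro ballI)
    fix i x assume "i \<in> I" "x \<in> elems ?Q"
    then have ix: "i \<in> I" "x \<in> X" by (simp_all add: quasi_crystal_of_def)
    have e: "y \<in> X \<and> aligned i x \<and> e i x = Some y \<and> aligned i y" if "qc_eop C i x = Some y" for y
      using that ix e_closed[OF ix] aligned_e_iff[OF ix] by (auto simp: qc_eop_eq split: if_splits)
    have f: "y \<in> X" if "qc_fop C i x = Some y" for y
      using that ix f_closed[OF ix] by (auto simp: qc_fop_eq split: if_splits)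
    have ef: "qc_eop C i x = Some y \<longleftrightarrow> qc_fop C i y = Some x" if "y \<in> X" for y
      using that ix by (auto simp: qc_eop_Some_iff qc_fop_eq)
    show "(\<forall>y. eop ?Q i x = Some y \<longrightarrow> y \<in> elems ?Q) \<and>
        (\<forall>y. fop ?Q i x = Some y \<longrightarrow> y \<in> elems ?Q) \<and>
        (\<forall>y\<in>elems ?Q. eop ?Q i x = Some y \<longleftrightarrow> fop ?Q i y = Some x) \<and>
        (\<forall>y\<in>elems ?Q. eop ?Q i x = Some y \<longrightarrow>
           (\<forall>k\<in>{1..n}. wt ?Q y k = wt ?Q x k + simple_root i k) \<and>
           eps ?Q i y = eps ?Q i x - 1 \<and>
           phi ?Q i y = phi ?Q i x + 1) \<and>
        phi ?Q i x = eps ?Q i x + Fin (pairing n (wt ?Q x) (simple_root i)) \<and>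
        (eps ?Q i x = Minf \<longrightarrow> eop ?Q i x = None \<and> fop ?Q i x = None)"
    proof (intro conjI allI ballI impI)
      fix y assume "y \<in> elems ?Q" "eop ?Q i x = Some y"
      then have y: "y \<in> X" "e i x = Some y" "aligned i x" "aligned i y"
        using e by (simp_all add: quasi_crystal_of_def)
      show "eps ?Q i y = eps ?Q i x - 1" "phi ?Q i y = phi ?Q i x + 1"
        using y ix wt_e_i[OF ix y(2)] wt_e_Suc[OF ix y(2)]
        by (simp_all add: quasi_crystal_of_def qc_eps_eq qc_phi_eq one_extended_def)
      show "wt ?Q y k = wt ?Q x k + simple_root i k" if "k \<in> {1..n}" for k
        using wt_e[OF ix y(2) that] by (simp add: quasi_crystal_of_def)
    qed (use e f ef ix in \<open>simp_all add: quasi_crystal_of_def qc_phi_def qc_eps_eq split: if_splits\<close>)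
  qed
  moreover have "is_string_length (qc_eop C) i x (qc_eps C i x) \<and>
      is_string_length (qc_fop C) i x (qc_phi n C i x)"
    if "i \<in> I" "x \<in> X" "qc_eps C i x \<noteq> Pinf" for i x
  proof -
    have al: "aligned i x" using that by (auto simp: qc_eps_eq split: if_splits)
    then have "qc_eps C i x = eps C i x" "qc_phi n C i x = phi C i x"
      using that aligned_iff_ph[of x i]
      by (auto simp: qc_eps_eq qc_phi_eq eps_eq phi_eq aligned_def)
    moreover have "is_string_length e i x (eps C i x)" "is_string_length f i x (phi C i x)"
      using stembridge that by (simp_all add: stembridge_crystal_def seminormal_crystal_def)
    ultimately show ?thesis
      unfolding is_string_length_def by (simp add: op_word_qc_eop op_word_qc_fop that al)
  qed
  moreover have "qc_eop C i x = None \<and> qc_fop C i x = None"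
    if "i \<in> I" "x \<in> X" "qc_eps C i x = Pinf" for i x
    using that by (simp add: qc_eps_eq qc_eop_eq qc_fop_eq split: if_splits)
  ultimately show ?thesis
    by (simp add: seminormal_quasi_crystal_def quasi_crystal_def)
      (simp add: quasi_crystal_of_def)
qed

lemma LQ1: "LQ1 n (quasi_crystal_of n C)"
proof -
  \<comment> \<open>Both \<open>ep i x\<close> and \<open>ph (i + 1) x\<close> lie between 0 and the
    same coordinate \<open>wt C x (i + 1)\<close>; if it is zero, both indices are aligned.\<close>
  have "aligned i x \<and> wt C x (i + 1) = 0 \<longleftrightarrow> aligned (i + 1) x \<and> wt C x (i + 1) = 0"
    if "i \<in> I" "i + 1 \<in> I" "x \<in> X" for i x
    using that ep_le_wt[of x i] ep_nonneg[of i x] ph_le_wt[of x "i + 1"] ph_nonneg[of "i + 1" x]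
      aligned_iff_ph[of x "i + 1"]
    by (auto simp: aligned_def)
  then show ?thesis
    by (auto simp: LQ1_def quasi_crystal_of_def qc_eps_eq qc_phi_eq zero_extended_def)
qed

section \<open>Alignment of the other indices along an i-edge of the quasi-crystal\<close>

context
  fixes i x y
  assumes i: "i \<in> I" and x: "x \<in> X" and e: "e i x = Some y" and al: "aligned i x"
begin

lemma aligned_e_far:
  assumes "j \<in> I" "j \<noteq> i" "j \<noteq> i + 1" "i \<noteq> j + 1"
  shows "aligned j y \<longleftrightarrow> aligned j x"
  using ep_e_far[OF i x e] wt_e_other[OF i x e, of "j + 1"] assms
  by (simp add: aligned_def index_set_def)

text \<open>Coordinate \<open>j + 1\<close> is untouched, while \<open>ep j\<close> cannot drop and
  is already at its upper bound.\<close>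

lemma aligned_e_above:
  assumes "j \<in> I" "i < j" "aligned j x"
  shows "aligned j y"
  using ep_e_cases[OF i x e, of j] wt_e_other[OF i x e, of "j + 1"] ep_le_wt[of y j] assms
    e_closed[OF i x e]
  by (auto simp: aligned_def index_set_def)

text \<open>Dually, coordinate \<open>j\<close> is untouched, and going from \<open>y\<close> down
  to \<open>x\<close> cannot lower \<open>ph j\<close>.\<close>

lemma aligned_e_below:
  assumes "j \<in> I" "j < i" "aligned j y"
  shows "aligned j x"
  using ep_e_cases[OF i x e, of j] ph_e_diff[OF i x e, of j] wt_e_other[OF i x e, of j]
    ph_le_wt[of x j] aligned_iff_ph[of _ j] assms e_closed[OF i x e] x
  by (auto simp: index_set_def split: if_splits)

text \<open>If \<open>i + 1\<close> becomes aligned, then \<open>ep (i + 1)\<close> rises and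
  \<open>ph (i + 1)\<close> is unchanged. Were the coordinate positive, S2' at \<open>y\<close>
  would give \<open>z = f (i + 1) y\<close> with \<open>ep i z = ep i y = wt C y (i + 1)\<close>,
  one more than \<open>ep_le_wt\<close> allows at \<open>z\<close>.\<close>

lemma aligned_e_Suc_iff:
  assumes "i + 1 \<in> I" "\<not> aligned (i + 1) x"
  shows "aligned (i + 1) y \<longleftrightarrow> wt C y (i + 1) = 0"
proof
  have y: "y \<in> X" using e_closed i x e by blast
  {
    assume "wt C y (i + 1) = 0"
    then show "aligned (i + 1) y"
      using ph_le_wt[of y "i + 1"] ph_nonneg[of "i + 1" y] aligned_iff_ph[of y "i + 1"] y assms
      by simp
  next
    assume al_y: "aligned (i + 1) y"
    show "wt C y (i + 1) = 0"
    proof (rule ccontr)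
      assume "wt C y (i + 1) \<noteq> 0"
      then have "0 < ph (i + 1) y"
        using al_y aligned_iff_ph[of y "i + 1"] ph_nonneg[of "i + 1" y] y assms by simp
      moreover have "ep (i + 1) y = ep (i + 1) x + 1"
        using ep_e_cases[OF i x e, of "i + 1"] wt_e_other[OF i x e, of "i + 2"] al_y assms
        by (auto simp: aligned_def index_set_def)
      then have "ph (i + 1) x = ph (i + 1) y"
        using ph_e_diff[OF i x e, of "i + 1"] assms by simp
      moreover have "f i y = Some x" using e_iff_f i x y e by blast
      ultimately obtain z where z: "f (i + 1) y = Some z" "ep i z = ep i y"
        using S2_f[of i "i + 1" y x] i y assms by auto
      then have "z \<in> X" "e (i + 1) z = Some y"
        using f_closed[of "i + 1" y z] e_iff_f[of "i + 1" z y] y assms by auto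
      then show False
        using ep_le_wt[of z i] wt_e_i[of "i + 1" z y] z assms i aligned_e_iff[OF i x e] al
        by (simp add: aligned_def)
    qed
  }
qed

text \<open>Dual to \<open>aligned_e_Suc_iff\<close>: for a positive coordinate, S2 at
  \<open>x\<close> gives \<open>z = e j x\<close> with \<open>ph i z = ph i x = wt C x i\<close>,
  one more than \<open>ph_le_wt\<close> allows at \<open>z\<close>.\<close>

lemma aligned_e_pred_iff:
  assumes "j \<in> I" "i = j + 1" "\<not> aligned j y"
  shows "aligned j x \<longleftrightarrow> wt C x i = 0"
proof
  have y: "y \<in> X" using e_closed i x e by blast
  {
    assume "wt C x i = 0"
    then show "aligned j x"
      using ep_le_wt[of x j] ep_nonneg[of j x] x assms by (simp add: aligned_def)
  next
    assume al_x: "aligned j x"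
    show "wt C x i = 0"
    proof (rule ccontr)
      assume "wt C x i \<noteq> 0"
      then have "0 < ep j x"
        using al_x ep_nonneg[of j x] x assms by (simp add: aligned_def)
      moreover have "ep j y = ep j x"
        using ep_e_cases[OF i x e, of j] wt_e_i[OF i x e] al_x assms
        by (auto simp: aligned_def)
      ultimately obtain z where z: "e j x = Some z" "ph i z = ph i x"
        using S2_e[of i j x y] i x e assms by auto
      then show False
        using ph_le_wt[of z i] wt_e_Suc[of j x z] e_closed[of j x z] aligned_iff_ph[of x i]
          assms i x al by simp
    qed
  }
qed

end

lemma LQ2: "LQ2 n (quasi_crystal_of n C)"
proof -
  let ?Q = "quasi_crystal_of n C"
  show ?thesis
    unfolding LQ2_def
  proof (intro ballI impI)
    fix i x y assume "i \<in> I" "x \<in> elems ?Q" "y \<in> elems ?Q" "eop ?Q i x = Some y"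
    then have i: "i \<in> I" and x: "x \<in> X" and y: "y \<in> X" and e: "e i x = Some y" and al: "aligned i x"
      by (auto simp: quasi_crystal_of_def qc_eop_eq split: if_splits)
    note edge = i x e al
    have al_y: "aligned i y" using aligned_e_iff[OF i x e] al by simp
    have far: "qc_eps C j x = qc_eps C j y" if "j \<in> I" "\<bar>int i - int j\<bar> > 1" for j
      using aligned_e_far[OF edge, of j] wt_e_other[OF i x e, of "j + 1"] that x y
      by (auto simp: qc_eps_eq index_set_def)
    have above: "(qc_eps C (i + 1) x \<noteq> qc_eps C (i + 1) y \<longleftrightarrow>
          qc_eps C (i + 1) x = Pinf \<and> qc_eps C i y = 0) \<and>
        (qc_eps C (i + 1) x = Pinf \<and> qc_eps C i y = 0 \<longrightarrow> qc_eps C (i + 1) y \<noteq> 0)"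
      if j: "i + 1 \<in> I"
    proof -
      have w: "wt C y (i + 2) = wt C x (i + 2)"
        using wt_e_other[OF i x e, of "i + 2"] j by (simp add: index_set_def)
      show ?thesis
      proof (cases "aligned (i + 1) x")
        case True
        then show ?thesis using aligned_e_above[OF edge, of "i + 1"] j w x y by (simp add: qc_eps_eq)
      next
        case False
        \<comment> \<open>The bound on \<open>ep (i + 1) x\<close> is strict without alignment.
          Hence the length at \<open>y\<close>, if finite, is nonzero.\<close>
        then have "0 < wt C x (i + 2)"
          using ep_le_wt[of x "i + 1"] ep_nonneg[of "i + 1" x] j x by (simp add: aligned_def)
        then show ?thesis
          using False aligned_e_Suc_iff[OF edge j] j w x y i al_y
          by (auto simp: qc_eps_eq zero_extended_def)
      qed
    qed
    have below: "(qc_phi n C (i - 1) x \<noteq> qc_phi n C (i - 1) y \<longleftrightarrow>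
          qc_phi n C (i - 1) y = Pinf \<and> qc_phi n C i x = 0) \<and>
        (qc_phi n C (i - 1) y = Pinf \<and> qc_phi n C i x = 0 \<longrightarrow> qc_phi n C (i - 1) x \<noteq> 0)"
      if pred: "i - 1 \<in> I"
    proof -
      obtain j where j: "j \<in> I" "i = j + 1" "i - 1 = j"
        using pred by (cases i) (auto simp: index_set_def)
      have w: "wt C y j = wt C x j"
        using wt_e_other[OF i x e, of j] j by (simp add: index_set_def)
      show ?thesis
      proof (cases "aligned j y")
        case True
        then show ?thesis
          using aligned_e_below[OF edge, of j] j w x y unfolding j(3) by (simp add: qc_phi_eq)
      next
        case False
        \<comment> \<open>Strictness of the bound on \<open>ph j y\<close> makes
          \<open>qc_phi n C j x\<close> nonzero, since coordinate \<open>j\<close> is the same at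
          both ends.\<close>
        then have "0 < wt C y j"
          using ph_le_wt[of y j] ph_nonneg[of j y] aligned_iff_ph[of y j] j y by simp
        then show ?thesis
          using False aligned_e_pred_iff[OF edge j(1,2)] j(1) w x y i al unfolding j(3)
          by (auto simp: qc_phi_eq zero_extended_def)
      qed
    qed
    show "(\<forall>j\<in>I. \<bar>int i - int j\<bar> > 1 \<longrightarrow> eps ?Q j x = eps ?Q j y) \<and>
        (i + 1 \<in> I \<longrightarrow>
           (eps ?Q (i + 1) x \<noteq> eps ?Q (i + 1) y \<longleftrightarrow>
              eps ?Q (i + 1) x = Pinf \<and> eps ?Q i y = 0) \<and>
           (eps ?Q (i + 1) x = Pinf \<and> eps ?Q i y = 0 \<longrightarrow> eps ?Q (i + 1) y \<noteq> 0)) \<and>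
        (i - 1 \<in> I \<longrightarrow>
           (phi ?Q (i - 1) x \<noteq> phi ?Q (i - 1) y \<longleftrightarrow>
              phi ?Q (i - 1) y = Pinf \<and> phi ?Q i x = 0) \<and>
           (phi ?Q (i - 1) y = Pinf \<and> phi ?Q i x = 0 \<longrightarrow> phi ?Q (i - 1) x \<noteq> 0))"
      using far above below by (simp add: quasi_crystal_of_def)
  qed
qed

section \<open>Commuting squares: LQ3 and LQ3'\<close>

lemma qc_eop_commute:
  assumes "i \<in> I" "j \<in> I" "i < j" "x \<in> X" "qc_eop C i x = Some y" "qc_eop C j x = Some z"
  obtains w where "qc_eop C j y = Some w" "qc_eop C i z = Some w"
proof -
  have al: "aligned i x" "aligned j x" and e: "e i x = Some y" "e j x = Some z"
    using assms by (auto simp: qc_eop_eq split: if_splits)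
  have y: "y \<in> X" and z: "z \<in> X" using e assms e_closed by blast+
  \<comment> \<open>The larger index stays aligned under e_i, which forces \<open>ep j\<close> to be
    unchanged, as S2 requires.\<close>
  have al_y: "aligned j y" using aligned_e_above[OF assms(1,4) e(1) al(1) assms(2,3) al(2)] .
  then have "ep j y = ep j x"
    using al wt_e_other[OF assms(1,4) e(1), of "j + 1"] assms
    by (simp add: aligned_def index_set_def)
  then obtain w where w: "e i z = Some w" "e j y = Some w" "ph i z = ph i x"
    using S2_e[of i j x y] e_defined_iff[of j x] e assms by auto
  \<comment> \<open>The \<open>ph\<close> equality in S2 suffices, because e_j with
    \<open>j > i\<close> does not touch coordinate \<open>i\<close>.\<close>
  moreover have "aligned i z"
    using w al wt_e_other[OF assms(2,4) e(2), of i] aligned_iff_ph[of _ i] assms z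
    by (simp add: index_set_def)
  ultimately show thesis using that al_y assms y z by (simp add: qc_eop_eq)
qed

lemma qc_fop_commute:
  assumes "i \<in> I" "j \<in> I" "i < j" "x \<in> X" "qc_fop C i x = Some y" "qc_fop C j x = Some z"
  obtains w where "qc_fop C j y = Some w" "qc_fop C i z = Some w"
proof -
  have al: "aligned i x" "aligned j x" and f: "f i x = Some y" "f j x = Some z"
    using assms by (auto simp: qc_fop_eq split: if_splits)
  have y: "y \<in> X" and z: "z \<in> X" using f assms f_closed by blast+
  have e: "e i y = Some x" "e j z = Some x" using f e_iff_f assms y z by auto
  have wt: "wt C x i = wt C z i" "wt C x (j + 1) = wt C y (j + 1)"
    using wt_e_other[OF assms(2) z e(2), of i] wt_e_other[OF assms(1) y e(1), of "j + 1"] assms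
    by (auto simp: index_set_def)
  \<comment> \<open>In the dual square the smaller index is treated first: f_j cannot lower
    \<open>ph i\<close>, which is already at its upper bound. S2' then gives the alignment of
    \<open>j\<close> at \<open>y\<close> through \<open>ep j\<close>.\<close>
  have al_z: "aligned i z"
    using ep_e_cases[OF assms(2) z e(2), of i] ph_e_diff[OF assms(2) z e(2), of i]
      ph_le_wt[of z i] aligned_iff_ph[of _ i] wt(1) al assms z
    by (auto split: if_splits)
  then have "ph i z = ph i x"
    using al wt aligned_iff_ph[of _ i] assms z by simp
  then obtain w where w: "f j y = Some w" "f i z = Some w" "ep j y = ep j x"
    using S2_f[of j i x z] f_defined_iff[of i x] f assms by auto
  moreover have "aligned j y" using w al wt by (simp add: aligned_def)
  ultimately show thesis using that al_z assms y z by (simp add: qc_fop_eq)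
qed

lemma LQ3: "LQ3 n (quasi_crystal_of n C)"
proof -
  have "op_word (qc_eop C) [i, j] x = op_word (qc_eop C) [j, i] x \<and>
      op_word (qc_eop C) [i, j] x \<noteq> None"
    if asm: "i \<in> I" "j \<in> I" "i \<noteq> j" "x \<in> X" "qc_eop C i x = Some y" "qc_eop C j x = Some z"
    for i j x y z
  proof -
    obtain w where "qc_eop C j y = Some w" "qc_eop C i z = Some w"
    proof (cases "i < j")
      case True
      then show thesis using qc_eop_commute[OF asm(1,2) _ asm(4,5,6)] that by blast
    next
      case False
      then show thesis using qc_eop_commute[OF asm(2,1) _ asm(4,6,5)] asm(3) that by force
    qed
    then show ?thesis using asm by simp
  qed
  then show ?thesis unfolding LQ3_def quasi_crystal_of_def crystal_data.simps not_None_eq by blast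
qed

lemma LQ3': "LQ3' n (quasi_crystal_of n C)"
proof -
  have "op_word (qc_fop C) [i, j] x = op_word (qc_fop C) [j, i] x \<and>
      op_word (qc_fop C) [i, j] x \<noteq> None"
    if asm: "i \<in> I" "j \<in> I" "i \<noteq> j" "x \<in> X" "qc_fop C i x = Some y" "qc_fop C j x = Some z"
    for i j x y z
  proof -
    obtain w where "qc_fop C j y = Some w" "qc_fop C i z = Some w"
    proof (cases "i < j")
      case True
      then show thesis using qc_fop_commute[OF asm(1,2) _ asm(4,5,6)] that by blast
    next
      case False
      then show thesis using qc_fop_commute[OF asm(2,1) _ asm(4,6,5)] asm(3) that by force
    qed
    then show ?thesis using asm by simp
  qed
  then show ?thesis unfolding LQ3'_def quasi_crystal_of_def crystal_data.simps not_None_eq by blast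
qed

end

theorem theorem4p9:
  fixes n :: nat and C :: "'a crystal_data"
  assumes "stembridge_crystal n C"
    and "connected_crystal n C"
    and "partition_highest_weights n C"
  shows "seminormal_quasi_crystal n (quasi_crystal_of n C) \<and>
         LQ1 n (quasi_crystal_of n C) \<and>
         LQ2 n (quasi_crystal_of n C) \<and>
         LQ3 n (quasi_crystal_of n C) \<and>
         LQ3' n (quasi_crystal_of n C)"
proof -
  interpret normalized_stembridge n C using assms by unfold_locales
  show ?thesis using seminormal LQ1 LQ2 LQ3 LQ3' by blast
qed

end
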